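(* Let $S$ be a numerical semigroup with multiplicity $m(S)\leq 8$. Then $S$ satisfies Wilf's conjecture, that is, $f(S)+1 \leq n(S)\,\nu(S)$.
   Context: $\mathbb{N}$ denotes the natural numbers including $0$. A numerical semigroup is a submonoid $S$ of $(\mathbb{N},+)$ with finite complement in $\mathbb{N}$. The Frobenius number $f(S)$ is the largest integer not belonging to $S$. The multiplicity $m(S)$ is the least positive element of $S$. The embedding dimension $\nu(S)$ is the number of elements of the unique minimal system of generators of $S$. Finally $n(S)=|\{s\in S : s<f(S)\}| = |S\cap[0,f(S)]|$. *)

theory Defs
  imports Complex_Main
begin

definition add_submonoid :: "nat set \<Rightarrow> bool" where
  "add_submonoid S \<longleftrightarrow> 0 \<in> S \<and> (\<forall>x\<in>S. \<forall>y\<in>S. x + y \<in> S)"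

definition numerical_semigroup :: "nat set \<Rightarrow> bool" where
  "numerical_semigroup S \<longleftrightarrow> add_submonoid S \<and> finite (UNIV - S)"

(* An integer, not a natural number: the value is -1 for S = UNIV. *)
definition frobenius_number :: "nat set \<Rightarrow> int" where
  "frobenius_number S = (GREATEST z. z \<notin> int ` S)"

definition multiplicity :: "nat set \<Rightarrow> nat" where
  "multiplicity S = (LEAST s. s \<in> S \<and> 0 < s)"

definition minimal_generating_set :: "nat set \<Rightarrow> nat set \<Rightarrow> bool" where
  "minimal_generating_set S A \<longleftrightarrow>
     add_submonoid hull A = S \<and> (\<forall>B. B \<subset> A \<longrightarrow> add_submonoid hull B \<noteq> S)"

(* Lemma minimal_generating_set_ex1 below shows that the description is proper, and
   minimal_generating_set_finite that the cardinality is a genuine one. *)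
definition embedding_dimension :: "nat set \<Rightarrow> nat" where
  "embedding_dimension S = card (THE A. minimal_generating_set S A)"

definition left_count :: "nat set \<Rightarrow> nat" where
  "left_count S = card {s \<in> S. int s < frobenius_number S}"

lemma add_submonoid_hull: "add_submonoid (add_submonoid hull A)"
  by (rule hull_in) (auto simp: add_submonoid_def)

lemma numerical_semigroup_eventually:
  assumes "numerical_semigroup S"
  obtains N where "\<And>x. x \<ge> N \<Longrightarrow> x \<in> S"
proof -
  from assms have "finite (UNIV - S)"
    by (simp add: numerical_semigroup_def)
  then obtain N where "\<forall>x\<in>UNIV - S. x < N"
    using finite_nat_set_iff_bounded by blast
  then show thesis
    by (metis Diff_iff UNIV_I not_less that)
qed

lemma frobenius_number_greatest:
  assumes "numerical_semigroup S"
  shows "frobenius_number S \<notin> int ` S"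
    and "z \<notin> int ` S \<Longrightarrow> z \<le> frobenius_number S"
proof -
  obtain N where N: "\<And>x. x \<ge> N \<Longrightarrow> x \<in> S"
    using numerical_semigroup_eventually[OF assms] by blast
  define G where "G = {z. -1 \<le> z \<and> z \<notin> int ` S}"
  have le: "z < int N" if "z \<notin> int ` S" for z
  proof (rule ccontr)
    assume "\<not> z < int N"
    then have "z = int (nat z)" "nat z \<in> S"
      using N[of "nat z"] by auto
    with that show False by blast
  qed
  have "G \<subseteq> {-1..<int N}"
    using le by (auto simp: G_def)
  then have fin: "finite G"
    using finite_subset by blast
  have ne: "-1 \<in> G"
    by (auto simp: G_def)
  have max: "Max G \<in> G"
    using fin ne Max_in by blast
  have up: "z \<le> Max G" if "z \<notin> int ` S" for z
  proof (cases "-1 \<le> z")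
    case True
    then show ?thesis using that fin by (simp add: G_def)
  next
    case False
    then show ?thesis using Max_ge[OF fin ne] by linarith
  qed
  have "frobenius_number S = Max G"
    unfolding frobenius_number_def
    by (rule Greatest_equality) (use max up in \<open>auto simp: G_def\<close>)
  with max up show "frobenius_number S \<notin> int ` S"
    and "z \<notin> int ` S \<Longrightarrow> z \<le> frobenius_number S"
    by (auto simp: G_def)
qed

definition atoms :: "nat set \<Rightarrow> nat set" where
  "atoms S = {s \<in> S. s \<noteq> 0 \<and> (\<forall>a\<in>S. \<forall>b\<in>S. s = a + b \<longrightarrow> a = 0 \<or> b = 0)}"

lemma atoms_sumD:
  assumes "x \<in> atoms S" "a \<in> S" "b \<in> S" "x = a + b"
  shows "a = 0 \<or> b = 0"
proof -
  from assms(1) have "\<forall>a\<in>S. \<forall>b\<in>S. x = a + b \<longrightarrow> a = 0 \<or> b = 0"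
    by (simp add: atoms_def)
  with assms show ?thesis by blast
qed

lemma hull_atoms:
  assumes "add_submonoid S"
  shows "add_submonoid hull (atoms S) = S"
proof
  show "add_submonoid hull (atoms S) \<subseteq> S"
    by (rule hull_minimal) (use assms in \<open>auto simp: atoms_def\<close>)
  let ?H = "add_submonoid hull (atoms S)"
  have H: "0 \<in> ?H" "\<And>x y. x \<in> ?H \<Longrightarrow> y \<in> ?H \<Longrightarrow> x + y \<in> ?H"
    using add_submonoid_hull[of "atoms S"] by (auto simp: add_submonoid_def)
  have "s \<in> S \<longrightarrow> s \<in> ?H" for s
  proof (induction s rule: less_induct)
    case (less s)
    show ?case
    proof
      assume s: "s \<in> S"
      consider "s = 0" | "s \<in> atoms S"
        | a b where "a \<in> S" "b \<in> S" "s = a + b" "a \<noteq> 0" "b \<noteq> 0"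
        using s unfolding atoms_def by blast
      then show "s \<in> ?H"
      proof cases
        case 1
        then show ?thesis using H by simp
      next
        case 2
        then show ?thesis by (rule hull_inc)
      next
        case 3
        then show ?thesis using less[of a] less[of b] H(2)[of a b] by simp
      qed
    qed
  qed
  then show "S \<subseteq> ?H" by blast
qed

lemma atoms_subset:
  assumes "add_submonoid hull A = S"
  shows "atoms S \<subseteq> A"
proof
  fix x assume x: "x \<in> atoms S"
  show "x \<in> A"
  proof (rule ccontr)
    assume "x \<notin> A"
    have S: "add_submonoid S"
      using add_submonoid_hull[of A] assms by simp
    have "a + b \<noteq> x" if "a \<in> S - {x}" "b \<in> S - {x}" for a b
      using atoms_sumD[OF x, of a b] that x by (cases "a = 0") auto
    then have "add_submonoid (S - {x})"
      using x S by (auto simp: add_submonoid_def atoms_def)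
    moreover have "A \<subseteq> S - {x}"
      using assms hull_subset[of A add_submonoid] \<open>x \<notin> A\<close> by blast
    ultimately have "S \<subseteq> S - {x}"
      using assms hull_minimal[of A "S - {x}" add_submonoid] by simp
    then show False
      using x by (auto simp: atoms_def)
  qed
qed

lemma minimal_generating_set_iff:
  assumes "add_submonoid S"
  shows "minimal_generating_set S A \<longleftrightarrow> A = atoms S"
proof
  assume A: "minimal_generating_set S A"
  then have "atoms S \<subseteq> A"
    by (intro atoms_subset) (simp add: minimal_generating_set_def)
  then show "A = atoms S"
    using A hull_atoms[OF assms] unfolding minimal_generating_set_def by blast
next
  assume "A = atoms S"
  then show "minimal_generating_set S A"
    using hull_atoms[OF assms] atoms_subset unfolding minimal_generating_set_def by blast
qed

lemma minimal_generating_set_ex1: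
  assumes "add_submonoid S"
  shows "\<exists>!A. minimal_generating_set S A"
  using minimal_generating_set_iff[OF assms] by simp

lemma minimal_generating_set_finite:
  assumes "numerical_semigroup S" and "minimal_generating_set S A"
  shows "finite A"
proof -
  have "add_submonoid S"
    using assms(1) by (simp add: numerical_semigroup_def)
  then have A: "A = atoms S"
    using assms(2) minimal_generating_set_iff by blast
  obtain N where N: "\<And>x. x \<ge> N \<Longrightarrow> x \<in> S"
    using numerical_semigroup_eventually[OF assms(1)] by blast
  have "x < 2 * N + 2" if "x \<in> atoms S" for x
  proof (rule ccontr)
    assume "\<not> x < 2 * N + 2"
    then have "N + 1 \<in> S" "x - (N + 1) \<in> S" "x = (N + 1) + (x - (N + 1))"
      and ne: "x - (N + 1) \<noteq> 0"
      using N by auto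
    then have "N + 1 = 0 \<or> x - (N + 1) = 0"
      by (intro atoms_sumD[OF that])
    with ne show False by simp
  qed
  then show ?thesis
    unfolding A finite_nat_set_iff_bounded by blast
qed

end

theory Submission
  imports Defs
begin

text \<open>
  Fix \<open>S\<close> with multiplicity \<open>m\<close>, embedding dimension \<open>\<nu>\<close>, and Frobenius number \<open>F \<ge> 0\<close>, and let
  \<open>n\<close> be the number of elements of \<open>S\<close> up to \<open>F\<close>. If \<open>m \<le> 8\<close>, then either \<open>m \<le> 2 * \<nu>\<close> or
  \<open>\<nu> \<le> 3\<close>, and each alternative gives Wilf's inequality for a reason of its own that does not
  depend on the size of \<open>m\<close>. Both work with the Apery set \<open>Ap\<close>, which holds the least element of
  \<open>S\<close> in each residue class modulo \<open>m\<close>.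

  Many generators (\<open>m \<le> 2 * \<nu>\<close>). The class of \<open>w \<in> Ap\<close> has \<open>level w = (F + m - w) div m\<close>
  elements up to \<open>F\<close>, and \<open>n\<close> is the sum of the levels (\<open>card_below_F\<close>). Since
  \<open>F + 1 \<le> m * level 0 \<le> \<nu> * (2 * level 0)\<close>, it suffices that some further levels
  together reach \<open>level 0\<close>. Here the Apery elements that are not atoms come in: there are \<open>m - \<nu>\<close>
  of them, each is a sum \<open>u + v\<close> of nonzero Apery elements, and \<open>u + v \<le> F + m\<close> makes
  \<open>level u + level v\<close> at least \<open>level 0 - 1\<close> (\<open>level_add_ge\<close>). Apart from the case
  \<open>m - \<nu> \<le> 1\<close>, which needs less, \<open>u\<close> and \<open>v\<close> can be taken to be different. If the last unit is
  missing, then the residues of \<open>u\<close> and \<open>v\<close> both exceed that of \<open>F\<close> (\<open>level_add_eq_residue\<close>). Any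
  further Apery element below \<open>F\<close> would supply it, so all of them lie above \<open>F\<close>. Rounding then still makes up for the missing unit unless
  the residue of \<open>F\<close> is at least \<open>\<nu>\<close>, which \<open>no_two_small_Ap_elements\<close> excludes.

  Few generators (\<open>\<nu> \<le> 3\<close>). Suppose that each Apery element divides, in the order induced by \<open>S\<close>,
  one of \<open>t\<close> chosen Apery elements. Every gap is then \<open>M - m - s\<close> for one of the chosen \<open>M\<close> and some
  \<open>s \<in> S\<close> up to \<open>F\<close>, so that \<open>F + 1 \<le> (t + 1) * n\<close> (\<open>bound_by_cover\<close>). For two generators
  \<open>m\<close>, \<open>b\<close> the Apery set consists of multiples of \<open>b\<close> and \<open>t = 1\<close> works. For three generators
  \<open>m\<close>, \<open>b\<close>, \<open>c\<close>, write each Apery element as \<open>i * b + j * c\<close> with \<open>i\<close> least. The exponent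
  pairs form a staircase in the plane. Stepping into an inner corner of the staircase yields a
  multiple of \<open>m\<close> (\<open>inner_corner_residue\<close>), and two such corners would produce two congruent
  Apery elements. So there is at most one inner corner, hence at most two outer ones
  (\<open>staircase_cover\<close>), and \<open>t = 2\<close> works.
\<close>

section \<open>Staircases\<close>

text \<open>
  The point \<open>(Suc p, Suc q)\<close> is a minimal point outside the staircase, off both axes. Naming it by
  predecessors keeps both coordinates positive.
\<close>

definition inner_corner :: "(nat \<times> nat) set \<Rightarrow> nat \<Rightarrow> nat \<Rightarrow> bool" where
  "inner_corner E p q \<longleftrightarrow> (Suc p, Suc q) \<notin> E \<and> (p, Suc q) \<in> E \<and> (Suc p, q) \<in> E"

lemma boundary_step:
  fixes P :: "nat \<Rightarrow> bool"
  assumes "P a" "\<not> P b" "a < b"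
  obtains k where "a \<le> k" "k < b" "P k" "\<not> P (Suc k)"
proof -
  have "\<exists>k. a \<le> k \<and> k < b \<and> P k \<and> \<not> P (Suc k)"
  proof (rule ccontr)
    assume neg: "\<not> ?thesis"
    have "a + d \<le> b \<longrightarrow> P (a + d)" for d
    proof (induction d)
      case (Suc d)
      show ?case
      proof
        assume "a + Suc d \<le> b"
        with Suc have "P (a + d)" "a + d < b" "a \<le> a + d" by simp_all
        with neg have "P (Suc (a + d))" by blast
        then show "P (a + Suc d)" by simp
      qed
    qed (use assms in simp)
    from this[of "b - a"] assms show False by simp
  qed
  with that show thesis by blast
qed

text \<open>
  Take as \<open>(i1, j1)\<close> the last point of the topmost row and as \<open>(i2, j2)\<close> the top point of the rightmost
  column. A point covered by neither lies to the right of \<open>i1\<close> and above \<open>j2\<close>. Walking up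
  from it in column \<open>Suc i1\<close> and to the right in row \<open>Suc j2\<close>, one leaves the staircase at two
  different inner corners.
\<close>

lemma staircase_cover:
  fixes E :: "(nat \<times> nat) set"
  assumes fin: "finite E" and zero: "(0, 0) \<in> E"
    and down: "\<And>i j i' j'. (i, j) \<in> E \<Longrightarrow> i' \<le> i \<Longrightarrow> j' \<le> j \<Longrightarrow> (i', j') \<in> E"
    and corner: "\<And>p q p' q'. inner_corner E p q \<Longrightarrow> inner_corner E p' q' \<Longrightarrow> p = p'"
  shows "\<exists>i1 j1 i2 j2. (i1, j1) \<in> E \<and> (i2, j2) \<in> E \<and>
    (\<forall>i j. (i, j) \<in> E \<longrightarrow> i \<le> i1 \<and> j \<le> j1 \<or> i \<le> i2 \<and> j \<le> j2)"
proof -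
  have fin_row: "finite {i. (i, j) \<in> E}" for j
    using finite_vimageI[OF fin, of "\<lambda>i. (i, j)"] by (simp add: vimage_def inj_on_def)
  have fin_col: "finite {j. (i, j) \<in> E}" for i
    using finite_vimageI[OF fin, of "\<lambda>j. (i, j)"] by (simp add: vimage_def inj_on_def)
  define j1 where "j1 = Max {j. (0, j) \<in> E}"
  have j1: "(0, j1) \<in> E" and j1_max: "\<And>j. (0, j) \<in> E \<Longrightarrow> j \<le> j1"
    using Max_in[OF fin_col[of 0]] Max_ge[OF fin_col[of 0]] zero by (auto simp: j1_def)
  define i1 where "i1 = Max {i. (i, j1) \<in> E}"
  have i1: "(i1, j1) \<in> E" and i1_max: "\<And>i. (i, j1) \<in> E \<Longrightarrow> i \<le> i1"
    using Max_in[OF fin_row[of j1]] Max_ge[OF fin_row[of j1]] j1 by (auto simp: i1_def)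
  define i2 where "i2 = Max {i. (i, 0) \<in> E}"
  have i2: "(i2, 0) \<in> E" and i2_max: "\<And>i. (i, 0) \<in> E \<Longrightarrow> i \<le> i2"
    using Max_in[OF fin_row[of 0]] Max_ge[OF fin_row[of 0]] zero by (auto simp: i2_def)
  define j2 where "j2 = Max {j. (i2, j) \<in> E}"
  have j2: "(i2, j2) \<in> E" and j2_max: "\<And>j. (i2, j) \<in> E \<Longrightarrow> j \<le> j2"
    using Max_in[OF fin_col[of i2]] Max_ge[OF fin_col[of i2]] i2 by (auto simp: j2_def)
  have "i \<le> i1 \<and> j \<le> j1 \<or> i \<le> i2 \<and> j \<le> j2" if ij: "(i, j) \<in> E" for i j
  proof (rule ccontr)
    assume uncovered: "\<not> ?thesis"
    have "j \<le> j1" "i \<le> i2"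
      using j1_max i2_max down[OF ij, of 0 j] down[OF ij, of i 0] by auto
    with uncovered have far: "i1 < i" "j2 < j" by auto
    have top: "(Suc i1, j1) \<notin> E" using i1_max[of "Suc i1"] by auto
    have right: "(i2, Suc j2) \<notin> E" using j2_max[of "Suc j2"] by auto
    have low: "(Suc i1, j) \<in> E" "(i, Suc j2) \<in> E"
      using down[OF ij, of "Suc i1" j] down[OF ij, of i "Suc j2"] far by simp_all
    have "j < j1" using top low(1) \<open>j \<le> j1\<close> by (cases "j = j1") auto
    then obtain q where q: "j \<le> q" "q < j1" "(Suc i1, q) \<in> E" "(Suc i1, Suc q) \<notin> E"
      by (rule boundary_step[of "\<lambda>k. (Suc i1, k) \<in> E", OF low(1) top])
    have "i < i2" using right low(2) \<open>i \<le> i2\<close> by (cases "i = i2") auto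
    then obtain p where p: "i \<le> p" "p < i2" "(p, Suc j2) \<in> E" "(Suc p, Suc j2) \<notin> E"
      by (rule boundary_step[of "\<lambda>k. (k, Suc j2) \<in> E", OF low(2) right])
    have "inner_corner E i1 q"
      using q down[OF i1, of i1 "Suc q"] by (simp add: inner_corner_def)
    moreover have "inner_corner E p j2"
      using p down[OF j2, of "Suc p" j2] by (simp add: inner_corner_def)
    ultimately have "i1 = p" by (rule corner)
    with p far show False by simp
  qed
  with i1 j2 show ?thesis by blast
qed

section \<open>Apery sets\<close>

text \<open>
  The multiplicity \<open>m\<close> and the Frobenius number \<open>F\<close> of a numerical semigroup other than the whole
  of the natural numbers, so that \<open>F\<close> is itself a natural number.
\<close>

locale apery_setting =
  fixes S :: "nat set" and m F :: nat
  assumes submonoid: "add_submonoid S"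
    and m_in: "m \<in> S" and m_pos: "0 < m"
    and m_least: "\<And>s. s \<in> S \<Longrightarrow> 0 < s \<Longrightarrow> m \<le> s"
    and F_notin: "F \<notin> S"
    and above_F: "\<And>x. F < x \<Longrightarrow> x \<in> S"
begin

text \<open>
  The usual condition is \<open>w - m \<notin> S\<close> in the integers; written as a sum it avoids truncated
  subtraction.
\<close>

definition Ap :: "nat set" where
  "Ap = {w \<in> S. \<forall>s\<in>S. w \<noteq> s + m}"

lemma zero_in: "0 \<in> S"
  using submonoid by (simp add: add_submonoid_def)

lemma add_in: "x \<in> S \<Longrightarrow> y \<in> S \<Longrightarrow> x + y \<in> S"
  using submonoid by (simp add: add_submonoid_def)

lemma mult_in: "x \<in> S \<Longrightarrow> k * x \<in> S"
  by (induction k) (auto simp: zero_in add_in)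

lemma Ap_in: "w \<in> Ap \<Longrightarrow> w \<in> S"
  by (simp add: Ap_def)

lemma zero_Ap: "0 \<in> Ap"
  using m_pos zero_in by (simp add: Ap_def)

lemma Ap_gt_m:
  assumes "w \<in> Ap" "w \<noteq> 0" shows "m < w"
proof -
  have "m \<le> w"
    using assms m_least by (simp add: Ap_def)
  moreover have "w \<noteq> 0 + m"
    using assms(1) zero_in unfolding Ap_def by blast
  ultimately show ?thesis by simp
qed

lemma Ap_le:
  assumes "w \<in> Ap" shows "w \<le> F + m"
proof (rule ccontr)
  assume "\<not> w \<le> F + m"
  then have "w - m \<in> S" "w = (w - m) + m"
    by (auto intro: above_F)
  with assms show False unfolding Ap_def by blast
qed

lemma finite_Ap: "finite Ap"
  using Ap_le by (meson finite_nat_set_iff_bounded_le)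

lemma Ap_not_shift:
  assumes "w \<in> Ap" "s \<in> S" shows "w \<noteq> s + Suc t * m"
proof
  assume "w = s + Suc t * m"
  then have "w = (s + t * m) + m" by simp
  moreover have "s + t * m \<in> S"
    using assms(2) by (intro add_in mult_in m_in)
  ultimately show False
    using assms(1) unfolding Ap_def by blast
qed

text \<open>
  The largest Apery element: the bound of \<open>Ap_le\<close> is attained.
\<close>

lemma F_add_m_Ap: "F + m \<in> Ap"
  using above_F[of "F + m"] m_pos F_notin by (auto simp: Ap_def)

lemma Ap_summand:
  assumes "x + y \<in> Ap" "x \<in> S" "y \<in> S" shows "x \<in> Ap"
proof -
  have "x \<noteq> s + m" if "s \<in> S" for s
  proof
    assume "x = s + m"
    then have "x + y = (s + y) + m" by simp
    then show False
      using assms(1) add_in[OF that assms(3)] unfolding Ap_def by blast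
  qed
  then show ?thesis using assms(2) by (simp add: Ap_def)
qed

lemma Ap_decomposition:
  assumes "s \<in> S" obtains w t where "w \<in> Ap" "s = w + t * m"
proof -
  have "s \<in> S \<longrightarrow> (\<exists>w\<in>Ap. \<exists>t. s = w + t * m)"
  proof (induction s rule: less_induct)
    case (less s)
    show ?case
    proof
      assume s: "s \<in> S"
      show "\<exists>w\<in>Ap. \<exists>t. s = w + t * m"
      proof (cases "s \<in> Ap")
        case True
        then show ?thesis by (intro bexI[of _ s] exI[of _ 0]) auto
      next
        case False
        then obtain s' where s': "s' \<in> S" "s = s' + m"
          using s by (auto simp: Ap_def)
        with less.IH[of s'] m_pos obtain w t where "w \<in> Ap" "s' = w + t * m" by auto
        with s' show ?thesis by (intro bexI[of _ w] exI[of _ "Suc t"]) auto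
      qed
    qed
  qed
  with assms that show thesis by blast
qed

lemma Ap_mod_eq:
  assumes "w \<in> Ap" "w' \<in> Ap" "w mod m = w' mod m" shows "w = w'"
proof -
  have "\<not> x < y" if x: "x \<in> Ap" and y: "y \<in> Ap" and mod: "x mod m = y mod m" for x y
  proof
    assume "x < y"
    moreover from this obtain k where k: "y = x + m * k"
      using mod_eq_nat1E[OF mod[symmetric]] by (metis less_imp_le)
    ultimately obtain t where "k = Suc t"
      by (cases k) auto
    then have "y = x + Suc t * m"
      using k by (simp add: algebra_simps)
    then show False using Ap_not_shift[OF y Ap_in[OF x]] by blast
  qed
  from this[of w w'] this[of w' w] assms show ?thesis by simp
qed

lemma Ap_residue:
  obtains w where "w \<in> Ap" "w mod m = x mod m"
proof -
  \<comment> \<open>Raise \<open>x\<close> within its class until it passes \<open>F\<close>, then descend in \<open>S\<close>.\<close>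
  have "F < x + Suc F * m"
    using m_pos by (cases m) auto
  then have "x + Suc F * m \<in> S" by (rule above_F)
  then obtain w t where w: "w \<in> Ap" "x + Suc F * m = w + t * m"
    by (rule Ap_decomposition)
  from arg_cong[OF w(2), of "\<lambda>x. x mod m"] have "w mod m = x mod m"
    by (simp only: mod_mult_self1)
  with w that show thesis by blast
qed

lemma card_Ap: "card Ap = m"
proof -
  have "bij_betw (\<lambda>w. w mod m) Ap {..<m}"
  proof (rule bij_betwI')
    show "(x mod m = y mod m) = (x = y)" if "x \<in> Ap" "y \<in> Ap" for x y
      using that Ap_mod_eq by blast
    show "x mod m \<in> {..<m}" for x
      using m_pos by simp
    show "\<exists>w\<in>Ap. r = w mod m" if "r \<in> {..<m}" for r
    proof -
      obtain w where "w \<in> Ap" "w mod m = r mod m" by (rule Ap_residue)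
      with that show ?thesis by auto
    qed
  qed
  then show ?thesis
    by (simp add: bij_betw_same_card)
qed

section \<open>Counting by residue classes\<close>

text \<open>
  The number of elements of \<open>S\<close> up to \<open>F\<close> in the residue class of the Apery element \<open>w\<close>: these are
  the \<open>w + t * m\<close> with \<open>t < level w\<close>. Since Apery elements are at most \<open>F + m\<close>, the formula gives
  \<open>0\<close> exactly for those above \<open>F\<close>.
\<close>

definition level :: "nat \<Rightarrow> nat" where
  "level w = (F + m - w) div m"

lemma less_level_iff:
  assumes "w \<in> Ap" shows "t < level w \<longleftrightarrow> w + t * m \<le> F"
proof -
  have "t < level w \<longleftrightarrow> Suc t \<le> level w"
    by (rule Suc_le_eq[symmetric])
  also have "\<dots> \<longleftrightarrow> Suc t * m \<le> F + m - w"
    unfolding level_def by (rule less_eq_div_iff_mult_less_eq[OF m_pos])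
  also have "\<dots> \<longleftrightarrow> w + t * m \<le> F"
    using Ap_le[OF assms] by auto
  finally show ?thesis .
qed

lemma card_below_F: "card {s \<in> S. s \<le> F} = (\<Sum>w\<in>Ap. level w)"
proof -
  have "bij_betw (\<lambda>(w, t). w + t * m) (SIGMA w:Ap. {..<level w}) {s \<in> S. s \<le> F}"
    unfolding bij_betw_def
  proof
    show "inj_on (\<lambda>(w, t). w + t * m) (SIGMA w:Ap. {..<level w})"
    proof (rule inj_onI, clarify)
      fix w t w' t'
      assume w: "w \<in> Ap" "w' \<in> Ap" and eq: "w + t * m = w' + t' * m"
      from arg_cong[OF eq, of "\<lambda>x. x mod m"] have "w mod m = w' mod m" by simp
      with w have "w = w'" by (rule Ap_mod_eq)
      with eq m_pos show "w = w' \<and> t = t'" by simp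
    qed
    show "(\<lambda>(w, t). w + t * m) ` (SIGMA w:Ap. {..<level w}) = {s \<in> S. s \<le> F}"
    proof (intro equalityI subsetI)
      fix s assume "s \<in> (\<lambda>(w, t). w + t * m) ` (SIGMA w:Ap. {..<level w})"
      then show "s \<in> {s \<in> S. s \<le> F}"
        by (auto simp: less_level_iff Ap_in add_in mult_in m_in)
    next
      fix s assume "s \<in> {s \<in> S. s \<le> F}"
      moreover from this obtain w t where "w \<in> Ap" "s = w + t * m"
        using Ap_decomposition by blast
      ultimately show "s \<in> (\<lambda>(w, t). w + t * m) ` (SIGMA w:Ap. {..<level w})"
        by (force simp: less_level_iff)
    qed
  qed
  from bij_betw_same_card[OF this] show ?thesis
    using finite_Ap by simp
qed

lemma level_sum_le:
  assumes "A \<subseteq> Ap" shows "(\<Sum>w\<in>A. level w) \<le> card {s \<in> S. s \<le> F}"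
  unfolding card_below_F using finite_Ap assms by (intro sum_mono2) auto

text \<open>
  The exact amount by which \<open>m * level 0\<close> overshoots \<open>F + 1\<close> matters: in the tight cases this
  rounding term is what closes the gap.
\<close>

lemma level_zero: "m * level 0 = F + 1 + (m - 1 - F mod m)"
proof -
  have "m * (F div m) + F mod m = F" "F mod m < m"
    using m_pos by auto
  moreover have "level 0 = Suc (F div m)"
    using m_pos by (simp add: level_def)
  ultimately show ?thesis by (simp only: mult_Suc_right)
qed

text \<open>
  \<open>F + m\<close> is at most the sum of \<open>F + m - u\<close> and \<open>F + m - v\<close>, and rounding down two quotients
  instead of one loses at most one.
\<close>

lemma level_add_ge:
  assumes "u + v \<le> F + m" shows "level 0 \<le> level u + level v + 1"
proof -
  define a b where "a = F + m - u" and "b = F + m - v"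
  have "F + m \<le> a + b" using assms by (simp add: a_def b_def)
  then have "level 0 \<le> (a + b) div m"
    unfolding level_def by (intro div_le_mono) simp
  also have "\<dots> \<le> a div m + b div m + 1"
  proof -
    have "a mod m + b mod m < 2 * m"
      using mod_less_divisor[OF m_pos, of a] mod_less_divisor[OF m_pos, of b] by linarith
    then have "(a mod m + b mod m) div m < 2"
      by (rule less_mult_imp_div_less)
    then show ?thesis using div_add1_eq[of a b m] by linarith
  qed
  finally show ?thesis by (simp add: level_def a_def b_def)
qed

text \<open>
  Losing one in \<open>level_add_ge\<close> needs a carry: the residues of \<open>F + m - u\<close> and \<open>F + m - v\<close> must add
  up to at least \<open>m\<close> more than that of \<open>F\<close>. So \<open>F + m - u\<close> has a larger residue than \<open>F\<close>, and
  subtracting it from \<open>F + m\<close> borrows.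
\<close>

lemma level_add_eq_residue:
  assumes le: "u + v \<le> F + m" and eq: "level 0 = level u + level v + 1"
  shows "F mod m < u mod m"
proof -
  define a b r where "a = F + m - u" and "b = F + m - v" and "r = F mod m"
  have a: "m * level u + a mod m = a" and b: "m * level v + b mod m = b"
    by (simp_all add: level_def a_def b_def)
  have N: "m * level 0 + r = F + m"
    using level_zero m_pos mod_less_divisor[OF m_pos, of F] unfolding r_def by linarith
  have "m * level 0 = m * level u + m * level v + m"
    by (simp add: eq algebra_simps)
  moreover have "F + m \<le> a + b" "b mod m < m" "a mod m < m"
    using le m_pos by (simp_all add: a_def b_def)
  ultimately have r: "r < a mod m"
    using a b N by linarith
  have "u = (m + r - a mod m) + m * level v"
    using a N le \<open>a mod m < m\<close> \<open>m * level 0 = _\<close> by (simp add: a_def)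
  moreover have "m + r - a mod m < m"
    using r \<open>a mod m < m\<close> by simp
  ultimately have "u mod m = m + r - a mod m" by simp
  then show ?thesis
    using \<open>a mod m < m\<close> by (simp add: r_def)
qed

section \<open>Decomposable Apery elements\<close>

definition decomposables :: "nat set" where
  "decomposables = Ap - {0} - atoms S"

lemma decomposableE:
  assumes "w \<in> decomposables"
  obtains x y where "x \<in> Ap" "y \<in> Ap" "x \<noteq> 0" "y \<noteq> 0" "w = x + y"
proof -
  from assms obtain x y where xy: "x \<in> S" "y \<in> S" "x \<noteq> 0" "y \<noteq> 0" "w = x + y"
    by (auto simp: decomposables_def atoms_def Ap_def)
  moreover have "x \<in> Ap" "y \<in> Ap"
    using assms xy Ap_summand[of x y] Ap_summand[of y x]
    by (auto simp: decomposables_def add.commute)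
  ultimately show thesis using that by blast
qed

lemma m_atom: "m \<in> atoms S"
proof -
  have "a = 0 \<or> b = 0" if "a \<in> S" "b \<in> S" "m = a + b" for a b
    using m_least[OF that(1)] m_least[OF that(2)] that(3) by auto
  then show ?thesis using m_in m_pos by (auto simp: atoms_def)
qed

lemma atoms_minus_m: "atoms S - {m} \<subseteq> Ap - {0}"
proof
  fix x assume x: "x \<in> atoms S - {m}"
  have "x \<noteq> s + m" if "s \<in> S" for s
    using atoms_sumD[of x S s m] x that m_in m_pos by auto
  with x show "x \<in> Ap - {0}" by (auto simp: Ap_def atoms_def)
qed

lemma finite_atoms: "finite (atoms S)"
  using finite_subset[OF atoms_minus_m] finite_Ap by simp

text \<open>
  Of the \<open>m - 1\<close> nonzero Apery elements all but the \<open>\<nu> - 1\<close> atoms other than \<open>m\<close> are decomposable.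
\<close>

lemma card_atoms: "card (atoms S) + card decomposables = m"
proof -
  have "m \<notin> Ap"
    using Ap_gt_m m_pos by blast
  then have "Ap - {0} = (atoms S - {m}) \<union> decomposables"
    using atoms_minus_m by (auto simp: decomposables_def)
  moreover have "(atoms S - {m}) \<inter> decomposables = {}"
    by (auto simp: decomposables_def)
  moreover have "finite decomposables" "finite (atoms S - {m})"
    using finite_Ap finite_atoms by (auto simp: decomposables_def)
  ultimately have "card (Ap - {0}) = card (atoms S - {m}) + card decomposables"
    by (simp only: card_Un_disjoint)
  moreover have "card (Ap - {0}) = m - 1"
    using card_Ap zero_Ap finite_Ap by simp
  moreover have "card (atoms S - {m}) = card (atoms S) - 1" "card (atoms S) > 0"
    using m_atom finite_atoms by (auto simp: card_gt_0_iff)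
  ultimately show ?thesis using m_pos by simp
qed


section \<open>Many generators\<close>

text \<open>
  Modulo \<open>m\<close> the hypotheses read \<open>u = -1\<close> and \<open>v = -2\<close>.
\<close>

lemma Ap_mod_double:
  assumes "u mod m = m - 1" "v mod m = m - 2" "2 \<le> m" "2 * u \<in> Ap" "v \<in> Ap"
  shows "v = 2 * u"
proof -
  have "2 * u = 2 * (m * (u div m) + (m - 1))"
    using assms(1) mult_div_mod_eq[of m u] by simp
  also have "\<dots> = (m - 2) + (2 * (u div m) + 1) * m"
    using assms(3) by (simp add: algebra_simps)
  finally have "2 * u mod m = (m - 2) mod m"
    by (simp only: mod_mult_self1)
  then have "v mod m = 2 * u mod m"
    using assms(2,3) by simp
  with assms(4,5) show ?thesis by (metis Ap_mod_eq)
qed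

text \<open>
  If \<open>u\<close> and \<open>v\<close> are the only nonzero Apery elements that may lie below \<open>F\<close>, then a decomposable Apery
  element has both summands in \<open>{u, v}\<close>, because each summand differs from it by more than \<open>m\<close>. So at
  most three are decomposable and \<open>\<nu> \<ge> m - 3\<close>. On the other hand \<open>u\<close> and \<open>v\<close> occupy two residues above
  that of \<open>F\<close>. If the latter were at least \<open>\<nu>\<close>, all these bounds would be equalities; the
  residues of \<open>u\<close> and \<open>v\<close> would be \<open>m - 1\<close> and \<open>m - 2\<close>, and since \<open>2 * (m - 1)\<close> is congruent to
  \<open>m - 2\<close>, one of \<open>u\<close>, \<open>v\<close> would be twice the other. With \<open>v = 2 * u\<close> the Apery elements
  \<open>u + v\<close> and \<open>2 * v\<close> both lie between \<open>F + 1\<close> and \<open>F + m\<close>, yet differ by \<open>u > m\<close>.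
\<close>

lemma no_two_small_Ap_elements:
  assumes u: "u \<in> Ap" "u \<noteq> 0" "F mod m < u mod m"
    and v: "v \<in> Ap" "u < v" "F mod m < v mod m"
    and large: "\<And>w. w \<in> Ap \<Longrightarrow> w \<notin> {0, u, v} \<Longrightarrow> F < w"
  shows "F mod m < card (atoms S)"
proof (rule ccontr)
  assume few: "\<not> F mod m < card (atoms S)"
  have small: "x \<in> {u, v}" if "x + y \<in> Ap" "x \<in> Ap" "y \<in> Ap" "x \<noteq> 0" "y \<noteq> 0" for x y
    using large[of x] Ap_le[OF that(1)] Ap_gt_m[OF that(3,5)] that by force
  have sub: "decomposables \<subseteq> {2 * u, u + v, 2 * v}"
  proof
    fix w assume w: "w \<in> decomposables"
    then obtain x y where xy: "x \<in> Ap" "y \<in> Ap" "x \<noteq> 0" "y \<noteq> 0" "w = x + y"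
      by (rule decomposableE)
    moreover have "w \<in> Ap" using w by (simp add: decomposables_def)
    ultimately have "x \<in> {u, v}" "y \<in> {u, v}"
      using small[of x y] small[of y x] by (auto simp: add.commute)
    with xy show "w \<in> {2 * u, u + v, 2 * v}" by auto
  qed
  have card3: "card {2 * u, u + v, 2 * v} = 3"
    using v by simp
  have le3: "card decomposables \<le> 3"
    using card_mono[OF _ sub] card3 by simp
  have ne: "u mod m \<noteq> v mod m"
    using Ap_mod_eq[OF u(1) v(1)] v(2) by blast
  have lt: "u mod m < m" "v mod m < m"
    using m_pos by simp_all
  have "card decomposables = 3" and m3: "3 \<le> m" and "F mod m = m - 3"
    using few le3 card_atoms ne lt u(3) v(3) by linarith+
  with sub card3 have all: "decomposables = {2 * u, u + v, 2 * v}"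
    by (intro card_seteq) auto
  then have sums: "2 * u \<in> Ap" "u + v \<in> Ap" "2 * v \<in> Ap"
    by (auto simp: decomposables_def)
  from ne lt u(3) v(3) \<open>F mod m = m - 3\<close> m3
  consider "u mod m = m - 1" "v mod m = m - 2" | "v mod m = m - 1" "u mod m = m - 2"
    by linarith
  then show False
  proof cases
    case 1
    with sums v m3 have "v = 2 * u" by (intro Ap_mod_double) auto
    moreover have "F < u + v" using large sums u v by auto
    moreover have "2 * v \<le> F + m" using sums Ap_le by blast
    moreover have "m < u" using u Ap_gt_m by blast
    ultimately show False by linarith
  next
    case 2
    with sums u m3 have "u = 2 * v" by (intro Ap_mod_double) auto
    with v show False by simp
  qed
qed

text \<open>
  The case distinction is on the number of decomposable Apery elements. With none, \<open>\<nu> = m\<close> and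
  \<open>level 0\<close> alone suffices. With one, \<open>\<nu> = m - 1\<close>, and doubling the least nonzero Apery element
  \<open>u\<close> already stays within \<open>F + m\<close>. With at least two, one of them differs from \<open>2 * u\<close>, so that it
  has a summand \<open>v \<noteq> u\<close>; as \<open>u\<close> is least, \<open>u + v \<le> F + m\<close>, and three different classes
  \<open>0\<close>, \<open>u\<close>, \<open>v\<close> contribute to \<open>n\<close>.
\<close>

lemma wilf_many_generators:
  assumes half: "m \<le> 2 * card (atoms S)"
  shows "F + 1 \<le> card (atoms S) * card {s \<in> S. s \<le> F}"
proof (cases "decomposables = {}")
  case True
  then have "card (atoms S) = m" using card_atoms by simp
  moreover have "level 0 \<le> card {s \<in> S. s \<le> F}"
    using level_sum_le[of "{0}"] zero_Ap by simp
  then have "m * level 0 \<le> m * card {s \<in> S. s \<le> F}"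
    by (rule mult_le_mono2)
  ultimately show ?thesis using level_zero by simp
next
  case False
  define \<nu> where "\<nu> = card (atoms S)"
  define n where "n = card {s \<in> S. s \<le> F}"
  have fin: "finite decomposables"
    using finite_Ap by (simp add: decomposables_def)
  define u where "u = (LEAST x. x \<in> Ap \<and> x \<noteq> 0)"
  have u: "u \<in> Ap" "u \<noteq> 0" and least: "\<And>x. x \<in> Ap \<Longrightarrow> x \<noteq> 0 \<Longrightarrow> u \<le> x"
  proof -
    have "\<exists>x. x \<in> Ap \<and> x \<noteq> 0"
      using False by (auto simp: decomposables_def)
    from LeastI_ex[OF this] show "u \<in> Ap" "u \<noteq> 0" by (simp_all add: u_def)
    show "u \<le> x" if "x \<in> Ap" "x \<noteq> 0" for x
      unfolding u_def using that by (intro Least_le) simp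
  qed
  have "\<nu> * n \<ge> F + 1"
  proof (cases "card decomposables = 1")
    case True
    then have m: "m = \<nu> + 1" using card_atoms by (simp add: \<nu>_def)
    obtain w where w: "w \<in> decomposables" using False by blast
    then obtain x y where xy: "x \<in> Ap" "y \<in> Ap" "x \<noteq> 0" "y \<noteq> 0" "w = x + y"
      by (rule decomposableE)
    have "w \<in> Ap" using w by (simp add: decomposables_def)
    \<comment> \<open>Three Apery elements force \<open>m \<ge> 3\<close>; this is where \<open>m = 2\<close> is excluded.\<close>
    then have "card {0, x, w} \<le> card Ap"
      using xy finite_Ap zero_Ap by (intro card_mono) auto
    then have "2 \<le> \<nu>" using xy m card_Ap by simp
    then have prod: "2 * level u \<le> \<nu> * level u" by simp
    have "level 0 + level u \<le> n"
      using level_sum_le[of "{0, u}"] zero_Ap u by (simp add: n_def)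
    from mult_le_mono2[OF this, of \<nu>] prod
    have n: "\<nu> * level 0 + 2 * level u \<le> \<nu> * n" unfolding distrib_left by linarith
    have m0: "m * level 0 = \<nu> * level 0 + level 0" by (simp add: m)
    have uu: "u + u \<le> F + m"
      using least[OF xy(1,3)] least[OF xy(2,4)] Ap_le[OF \<open>w \<in> Ap\<close>] xy(5) by linarith
    show ?thesis
    proof (cases "level 0 \<le> 2 * level u")
      case True
      then show ?thesis using n m0 level_zero by linarith
    next
      case False
      with level_add_ge[OF uu] have eq: "level 0 = level u + level u + 1" by simp
      have "F mod m < u mod m" "u mod m < m"
        using level_add_eq_residue[OF uu eq] m_pos by simp_all
      then show ?thesis using n m0 level_zero eq by linarith
    qed
  next
    case several: False
    have "\<not> decomposables \<subseteq> {2 * u}"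
    proof
      assume "decomposables \<subseteq> {2 * u}"
      with False have "decomposables = {2 * u}" by blast
      with several show False by simp
    qed
    then obtain w where w: "w \<in> decomposables" "w \<noteq> 2 * u" by blast
    then obtain x y where xy: "x \<in> Ap" "y \<in> Ap" "x \<noteq> 0" "y \<noteq> 0" "w = x + y"
      using decomposableE by blast
    have w_le: "w \<le> F + m" using w Ap_le by (simp add: decomposables_def)
    \<comment> \<open>One summand of \<open>w\<close> is not \<open>u\<close>; the other is at least \<open>u\<close> and may be replaced by it.\<close>
    obtain v where v: "v \<in> Ap" "v \<noteq> 0" "v \<noteq> u" and uv: "u + v \<le> F + m"
    proof (cases "x = u")
      case True
      with xy w w_le that[of y] show thesis by auto
    next
      case False
      with xy w_le least[of y] that[of x] show thesis by auto
    qed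
    have lt: "u < v" using least v by (simp add: le_neq_trans)
    have n: "level 0 + level u + level v \<le> n"
      using level_sum_le[of "{0, u, v}"] zero_Ap u v by (simp add: n_def)
    have two: ?thesis if "2 * level 0 \<le> n"
    proof -
      have "m * level 0 \<le> (2 * \<nu>) * level 0"
        using half unfolding \<nu>_def by (rule mult_le_mono1)
      also have "\<dots> \<le> \<nu> * n" using mult_le_mono2[OF that, of \<nu>] by (simp add: algebra_simps)
      finally show ?thesis using level_zero by simp
    qed
    show ?thesis
    proof (rule ccontr)
      assume contra: "\<not> ?thesis"
      with two have few: "n < 2 * level 0" by fastforce
      then have eq: "level 0 = level u + level v + 1"
        using n level_add_ge[OF uv] by linarith
      have res: "F mod m < u mod m" "F mod m < v mod m"
        using level_add_eq_residue[OF uv eq] level_add_eq_residue[of v u] uv eq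
        by (simp_all add: add.commute)
      \<comment> \<open>A fourth class that meets \<open>S\<close> below \<open>F\<close> would supply the missing unit.\<close>
      have "F < x" if x: "x \<in> Ap" "x \<notin> {0, u, v}" for x
      proof -
        have "level 0 + level u + level v + level x \<le> n"
          using level_sum_le[of "{x, 0, u, v}"] zero_Ap u v x by (simp add: n_def)
        with few eq have "level x = 0" by linarith
        then show ?thesis using less_level_iff[OF x(1), of 0] by simp
      qed
      with res u v lt have big: "F mod m < \<nu>"
        unfolding \<nu>_def by (intro no_two_small_Ap_elements[of u v]) auto
      \<comment> \<open>Now \<open>n = 2 * level 0 - 1\<close>, and the overshoot \<open>m - 1 - F mod m\<close> of \<open>level_zero\<close> exceeds \<open>m - 1 - \<nu>\<close>,
        which is enough because \<open>level 0\<close> is positive.\<close>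
      obtain l where l: "level 0 = Suc l" using eq by simp
      have "m * l \<le> (2 * \<nu>) * l"
        using half unfolding \<nu>_def by (rule mult_le_mono1)
      moreover have "2 * l + 1 \<le> n" using n eq l by simp
      from mult_le_mono2[OF this, of \<nu>] have "(2 * \<nu>) * l + \<nu> \<le> \<nu> * n"
        by (simp add: algebra_simps)
      moreover have "m * l + m = F + 1 + (m - 1 - F mod m)"
        using level_zero l by simp
      moreover have "F mod m < m" using m_pos by simp
      ultimately show False using contra big by linarith
    qed
  qed
  then show ?thesis by (simp add: \<nu>_def n_def)
qed

section \<open>Few generators\<close>

text \<open>
  A gap \<open>x\<close> lies below the Apery element \<open>w\<close> of its class, by a positive multiple of \<open>m\<close>. If
  \<open>M - w \<in> S\<close>, then also \<open>s = M - m - x \<in> S\<close>, and \<open>s \<le> F\<close> because \<open>M \<le> F + m\<close>. So a gap is determined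
  by a pair \<open>(M, s)\<close>, and there are at most \<open>card P * n\<close> gaps among the \<open>F + 1\<close> numbers up to \<open>F\<close>.
\<close>

lemma bound_by_cover:
  assumes "P \<subseteq> Ap" and cover: "\<And>w. w \<in> Ap \<Longrightarrow> \<exists>M\<in>P. \<exists>s\<in>S. M = w + s"
  shows "F + 1 \<le> (card P + 1) * card {s \<in> S. s \<le> F}"
proof -
  let ?L = "{s \<in> S. s \<le> F}" and ?G = "{x. x \<notin> S}"
  have "?G \<subseteq> (\<lambda>(M, s). M - m - s) ` (P \<times> ?L)"
  proof
    fix x assume "x \<in> ?G"
    then have x: "x \<notin> S" by simp
    obtain w where w: "w \<in> Ap" "w mod m = x mod m" by (rule Ap_residue)
    have "x < w"
    proof (rule ccontr)
      assume "\<not> x < w"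
      then obtain k where "x = w + m * k"
        using mod_eq_nat1E[OF w(2)[symmetric]] by (metis not_less)
      then have "x = w + k * m" by simp
      with x w show False by (metis Ap_in add_in mult_in m_in)
    qed
    then obtain k where k: "w = x + m * k"
      using mod_eq_nat1E[OF w(2)] by (metis less_imp_le)
    with \<open>x < w\<close> obtain j where j: "k = Suc j" by (cases k) auto
    obtain M s where M: "M \<in> P" "s \<in> S" "M = w + s" using cover[OF w(1)] by blast
    let ?s = "j * m + s"
    have eq: "M = x + m + ?s" using M k j by (simp add: algebra_simps)
    have "M \<le> F + m" using M assms(1) Ap_le by blast
    then have "?s \<in> ?L" using M eq by (auto intro: add_in mult_in m_in)
    moreover have "x = M - m - ?s" using eq by simp
    ultimately show "x \<in> (\<lambda>(M, s). M - m - s) ` (P \<times> ?L)"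
      using M(1) by (intro image_eqI[of _ _ "(M, ?s)"]) auto
  qed
  moreover have fin: "finite (P \<times> ?L)"
    using finite_subset[OF assms(1) finite_Ap] by simp
  ultimately have "card ?G \<le> card (P \<times> ?L)"
    by (rule surj_card_le[rotated])
  then have "card ?G \<le> card P * card ?L" by (simp add: card_cartesian_product)
  moreover have "{..F} = ?G \<union> ?L" "?G \<inter> ?L = {}"
    using above_F by (auto simp: not_less[symmetric])
  then have "F + 1 = card ?G + card ?L"
    by (metis card_Un_disjoint card_atMost Suc_eq_plus1 finite_atMost finite_Un)
  ultimately show ?thesis by simp
qed


text \<open>
  A representation of an Apery element by generators does not involve \<open>m\<close>.
\<close>

lemma Ap_combination:
  assumes "w \<in> Ap" "w = x * m + y" "y \<in> S" shows "w = y"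
proof (cases x)
  case (Suc t)
  with assms Ap_not_shift[of w y t] show ?thesis by (simp add: add.commute)
qed (use assms in simp)

lemma wilf_two_generators:
  assumes b: "b \<in> S" and gen: "\<And>s. s \<in> S \<Longrightarrow> \<exists>x y. s = x * m + y * b"
  shows "F + 1 \<le> 2 * card {s \<in> S. s \<le> F}"
proof -
  have multiple: "\<exists>y. w = y * b" if "w \<in> Ap" for w
    using gen[OF Ap_in[OF that]] Ap_combination[OF that] mult_in[OF b] by blast
  obtain k where k: "F + m = k * b" using multiple F_add_m_Ap by blast
  have "\<exists>s\<in>S. F + m = w + s" if w: "w \<in> Ap" for w
  proof -
    obtain i where i: "w = i * b" using multiple[OF w] by blast
    have "F + m - w = (k - i) * b" by (simp add: i k diff_mult_distrib)
    then have "F + m - w \<in> S" using mult_in[OF b] by simp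
    moreover have "F + m = w + (F + m - w)" using Ap_le[OF w] by simp
    ultimately show ?thesis by blast
  qed
  then have "F + 1 \<le> (card {F + m} + 1) * card {s \<in> S. s \<le> F}"
    using F_add_m_Ap by (intro bound_by_cover) auto
  then show ?thesis by simp
qed

lemma exponents_split:
  fixes b c :: nat
  assumes "i \<le> k" "j \<le> l"
  shows "k * b + l * c = (i * b + j * c) + ((k - i) * b + (l - j) * c)"
proof -
  from assms obtain d e where "k = i + d" "l = j + e" by (auto simp: le_iff_add)
  then show ?thesis by (simp add: distrib_right)
qed

text \<open>
  An Apery element may have several representations by \<open>b\<close> and \<open>c\<close>. Insisting on the least \<open>i\<close> selects
  one of them in a way that is inherited by smaller exponents, so that the exponent pairs form a
  staircase on which \<open>(i, j) \<mapsto> i * b + j * c\<close> is injective modulo \<open>m\<close>.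
\<close>

definition least_exponents :: "nat \<Rightarrow> nat \<Rightarrow> (nat \<times> nat) set" where
  "least_exponents b c = {(i, j). i * b + j * c \<in> Ap \<and>
     (\<forall>i' j'. i' * b + j' * c = i * b + j * c \<longrightarrow> i \<le> i')}"

lemma least_exponents_Ap: "(i, j) \<in> least_exponents b c \<Longrightarrow> i * b + j * c \<in> Ap"
  by (simp add: least_exponents_def)

lemma least_exponents_finite:
  assumes "0 < b" "0 < c" shows "finite (least_exponents b c)"
proof (rule finite_subset)
  show "least_exponents b c \<subseteq> {..F + m} \<times> {..F + m}"
  proof clarify
    fix i j assume "(i, j) \<in> least_exponents b c"
    then have "i * b + j * c \<le> F + m" by (intro Ap_le least_exponents_Ap)
    moreover have "i \<le> i * b" "j \<le> j * c" using assms by simp_all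
    ultimately show "i \<in> {..F + m} \<and> j \<in> {..F + m}"
      unfolding atMost_iff by linarith
  qed
qed simp

text \<open>
  A representation of \<open>i' * b + j' * c\<close> with a smaller first exponent would, after adding the
  missing exponents, give one of \<open>i * b + j * c\<close>.
\<close>

lemma least_exponents_down:
  assumes "b \<in> S" "c \<in> S" "(i, j) \<in> least_exponents b c" "i' \<le> i" "j' \<le> j"
  shows "(i', j') \<in> least_exponents b c"
proof -
  have split: "i * b + j * c = (i' * b + j' * c) + ((i - i') * b + (j - j') * c)"
    by (rule exponents_split[OF assms(4,5)])
  have "i' * b + j' * c \<in> Ap"
  proof (rule Ap_summand)
    show "(i' * b + j' * c) + ((i - i') * b + (j - j') * c) \<in> Ap"
      unfolding split[symmetric] by (rule least_exponents_Ap[OF assms(3)])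
    show "i' * b + j' * c \<in> S" "(i - i') * b + (j - j') * c \<in> S"
      using assms(1,2) by (simp_all add: add_in mult_in)
  qed
  moreover have "i' \<le> k" if "k * b + l * c = i' * b + j' * c" for k l
  proof -
    have "(k + (i - i')) * b + (l + (j - j')) * c = i * b + j * c"
      unfolding split that[symmetric] distrib_right by linarith
    then have "i \<le> k + (i - i')"
      using assms(3) unfolding least_exponents_def by blast
    then show ?thesis using assms(4) by simp
  qed
  ultimately show ?thesis
    unfolding least_exponents_def by blast
qed

lemma least_exponents_inj:
  assumes "0 < c" "(i, j) \<in> least_exponents b c" "(i', j') \<in> least_exponents b c"
    and "(i * b + j * c) mod m = (i' * b + j' * c) mod m"
  shows "i = i' \<and> j = j'"
proof -
  have eq: "i * b + j * c = i' * b + j' * c"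
    by (rule Ap_mod_eq[OF least_exponents_Ap[OF assms(2)] least_exponents_Ap[OF assms(3)] assms(4)])
  have "i \<le> i'"
    using assms(2) eq[symmetric] unfolding least_exponents_def by blast
  moreover have "i' \<le> i"
    using assms(3) eq unfolding least_exponents_def by blast
  ultimately have "i = i'" by simp
  moreover have "j * c = j' * c"
    using eq unfolding \<open>i = i'\<close> by (rule add_left_imp_eq)
  ultimately show ?thesis using assms(1) by simp
qed

lemma least_exponents_surj:
  assumes "b \<in> S" "c \<in> S" and gen: "\<And>s. s \<in> S \<Longrightarrow> \<exists>x y z. s = x * m + y * b + z * c"
    and w: "w \<in> Ap"
  obtains i j where "(i, j) \<in> least_exponents b c" "w = i * b + j * c"
proof -
  obtain x y z where "w = x * m + (y * b + z * c)"
    using gen[OF Ap_in[OF w]] by (auto simp: add.assoc)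
  then have "w = y * b + z * c"
    using Ap_combination[OF w] assms(1,2) by (blast intro: add_in mult_in)
  then have ex: "\<exists>i. \<exists>j. w = i * b + j * c" by blast
  define i where "i = (LEAST i. \<exists>j. w = i * b + j * c)"
  obtain j where j: "w = i * b + j * c"
    using LeastI_ex[OF ex] unfolding i_def by blast
  have "i \<le> i'" if "i' * b + j' * c = w" for i' j'
    unfolding i_def using that by (intro Least_le) auto
  with j w have "(i, j) \<in> least_exponents b c" by (auto simp: least_exponents_def)
  with j that show thesis by blast
qed

text \<open>
  Let \<open>i * b + j * c\<close> be the Apery element in the class of the corner. If \<open>i\<close> were positive, one \<open>b\<close> could
  be cancelled on both sides; this leaves two congruent exponent pairs of the staircase, which are
  equal by injectivity, so that the corner itself would belong to the staircase. The same holds for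
  \<open>j\<close> and \<open>c\<close>. So the Apery element is \<open>0\<close>.
\<close>

lemma inner_corner_residue:
  assumes bc: "b \<in> S" "c \<in> S" "0 < c"
    and gen: "\<And>s. s \<in> S \<Longrightarrow> \<exists>x y z. s = x * m + y * b + z * c"
    and corner: "inner_corner (least_exponents b c) p q"
  shows "(Suc p * b + Suc q * c) mod m = 0"
proof -
  let ?E = "least_exponents b c"
  have out: "(Suc p, Suc q) \<notin> ?E" and left: "(p, Suc q) \<in> ?E" and below: "(Suc p, q) \<in> ?E"
    using corner by (simp_all add: inner_corner_def)
  have "Suc p * b + Suc q * c \<in> S" using bc by (intro add_in mult_in)
  then obtain w t where w: "w \<in> Ap" and eq: "Suc p * b + Suc q * c = w + t * m"
    by (rule Ap_decomposition)
  obtain i j where ij: "(i, j) \<in> ?E" "w = i * b + j * c"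
    using least_exponents_surj[OF bc(1,2) gen w] by blast
  have "i = 0"
  proof (rule ccontr)
    assume "i \<noteq> 0"
    then obtain i' where i': "i = Suc i'" by (cases i) auto
    have "p * b + Suc q * c = (i' * b + j * c) + t * m" using eq ij i' by simp
    then have "(p * b + Suc q * c) mod m = (i' * b + j * c) mod m" by (simp only: mod_mult_self1)
    moreover have "(i', j) \<in> ?E"
      using least_exponents_down[OF bc(1,2) ij(1), of i' j] i' by simp
    ultimately have "p = i' \<and> Suc q = j" by (intro least_exponents_inj[OF bc(3) left])
    with ij i' out show False by simp
  qed
  moreover have "j = 0"
  proof (rule ccontr)
    assume "j \<noteq> 0"
    then obtain j' where j': "j = Suc j'" by (cases j) auto
    have "Suc p * b + q * c = (i * b + j' * c) + t * m" using eq ij j' by simp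
    then have "(Suc p * b + q * c) mod m = (i * b + j' * c) mod m" by (simp only: mod_mult_self1)
    moreover have "(i, j') \<in> ?E"
      using least_exponents_down[OF bc(1,2) ij(1), of i j'] j' by simp
    ultimately have "Suc p = i \<and> q = j'" by (intro least_exponents_inj[OF bc(3) below])
    with ij j' out show False by simp
  qed
  ultimately show ?thesis using eq ij by simp
qed

text \<open>
  Both corners are congruent to \<open>0\<close>. Cancelling the smaller of the coordinates in each direction
  leaves \<open>(q - q') * c\<close> congruent to \<open>(p' - p) * b\<close>, two points of the staircase on different
  axes.
\<close>

lemma inner_corner_unique:
  assumes bc: "b \<in> S" "c \<in> S" "0 < c"
    and gen: "\<And>s. s \<in> S \<Longrightarrow> \<exists>x y z. s = x * m + y * b + z * c"
    and corner: "inner_corner (least_exponents b c) p q"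
    and corner': "inner_corner (least_exponents b c) p' q'"
  shows "\<not> p < p'"
proof
  let ?E = "least_exponents b c"
  assume "p < p'"
  note down = least_exponents_down[OF bc(1,2)]
  have "q' < q"
  proof (rule ccontr)
    assume "\<not> q' < q"
    then have "(Suc p, Suc q) \<in> ?E"
      using down[of p' "Suc q'" "Suc p" "Suc q"] corner' \<open>p < p'\<close> by (simp add: inner_corner_def)
    with corner show False by (simp add: inner_corner_def)
  qed
  define z where "z = Suc p * b + Suc q' * c"
  have "(q - q') * c + z = Suc p * b + Suc q * c"
    using exponents_split[of "Suc p" "Suc p" "Suc q'" "Suc q" b c] \<open>q' < q\<close> by (simp add: z_def)
  moreover have "(p' - p) * b + z = Suc p' * b + Suc q' * c"
    using exponents_split[of "Suc p" "Suc p'" "Suc q'" "Suc q'" b c] \<open>p < p'\<close> by (simp add: z_def)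
  ultimately have "((q - q') * c + z) mod m = ((p' - p) * b + z) mod m"
    using inner_corner_residue[OF bc gen corner] inner_corner_residue[OF bc gen corner'] by simp
  then obtain k l where "(q - q') * c + z + m * k = (p' - p) * b + z + m * l"
    unfolding nat_mod_eq_iff by blast
  then have "(q - q') * c + m * k = (p' - p) * b + m * l" by simp
  then have "(0 * b + (q - q') * c) mod m = ((p' - p) * b + 0 * c) mod m"
    unfolding nat_mod_eq_iff by auto
  moreover have "(0, q - q') \<in> ?E"
    using down[of p "Suc q" 0 "q - q'"] corner by (simp add: inner_corner_def)
  moreover have "(p' - p, 0) \<in> ?E"
    using down[of "Suc p'" q' "p' - p" 0] corner' by (simp add: inner_corner_def)
  ultimately have "0 = p' - p"
    using least_exponents_inj[OF bc(3)] by blast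
  with \<open>p < p'\<close> show False by simp
qed

lemma wilf_three_generators:
  assumes bc: "b \<in> S" "c \<in> S" "0 < b" "0 < c"
    and gen: "\<And>s. s \<in> S \<Longrightarrow> \<exists>x y z. s = x * m + y * b + z * c"
  shows "F + 1 \<le> 3 * card {s \<in> S. s \<le> F}"
proof -
  let ?E = "least_exponents b c"
  have "p = p'" if "inner_corner ?E p q" "inner_corner ?E p' q'" for p q p' q'
    using inner_corner_unique[OF bc(1,2,4) gen that]
      inner_corner_unique[OF bc(1,2,4) gen that(2) that(1)] by simp
  then have "\<exists>i1 j1 i2 j2. (i1, j1) \<in> ?E \<and> (i2, j2) \<in> ?E \<and>
      (\<forall>i j. (i, j) \<in> ?E \<longrightarrow> i \<le> i1 \<and> j \<le> j1 \<or> i \<le> i2 \<and> j \<le> j2)"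
  proof (intro staircase_cover)
    show "finite ?E" by (rule least_exponents_finite[OF bc(3,4)])
    show "(0, 0) \<in> ?E" using zero_Ap by (simp add: least_exponents_def)
    show "(i', j') \<in> ?E" if "(i, j) \<in> ?E" "i' \<le> i" "j' \<le> j" for i j i' j'
      using that by (rule least_exponents_down[OF bc(1,2)])
  qed
  then obtain i1 j1 i2 j2 where top: "(i1, j1) \<in> ?E" "(i2, j2) \<in> ?E"
    and cover: "\<And>i j. (i, j) \<in> ?E \<Longrightarrow> i \<le> i1 \<and> j \<le> j1 \<or> i \<le> i2 \<and> j \<le> j2"
    by blast
  define P where "P = {i1 * b + j1 * c, i2 * b + j2 * c}"
  have above: "\<exists>s\<in>S. k * b + l * c = (i * b + j * c) + s" if "i \<le> k" "j \<le> l" for i j k l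
  proof
    show "(k - i) * b + (l - j) * c \<in> S" using bc by (intro add_in mult_in)
    show "k * b + l * c = (i * b + j * c) + ((k - i) * b + (l - j) * c)"
      by (rule exponents_split[OF that])
  qed
  have "F + 1 \<le> (card P + 1) * card {s \<in> S. s \<le> F}"
  proof (rule bound_by_cover)
    show "P \<subseteq> Ap" using top[THEN least_exponents_Ap] by (simp add: P_def)
    fix w assume "w \<in> Ap"
    then obtain i j where ij: "(i, j) \<in> ?E" "w = i * b + j * c"
      using least_exponents_surj[OF bc(1,2) gen] by blast
    from cover[OF ij(1)] show "\<exists>M\<in>P. \<exists>s\<in>S. M = w + s"
    proof
      assume "i \<le> i1 \<and> j \<le> j1"
      then show ?thesis using above[of i i1 j j1] by (simp add: P_def ij(2))
    next
      assume "i \<le> i2 \<and> j \<le> j2"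
      then show ?thesis using above[of i i2 j j2] by (simp add: P_def ij(2))
    qed
  qed
  also have "\<dots> \<le> 3 * card {s \<in> S. s \<le> F}"
    by (intro mult_le_mono1) (simp add: P_def card_insert_if)
  finally show ?thesis .
qed

section \<open>Multiplicity at most eight\<close>

lemma combinations_submonoid: "add_submonoid {x * m + y * b + z * c | x y z. True}"
  unfolding add_submonoid_def
proof (intro conjI ballI)
  have "0 = 0 * m + 0 * b + 0 * c" by simp
  then show "0 \<in> {x * m + y * b + z * c | x y z. True}" by blast
next
  fix s t
  assume "s \<in> {x * m + y * b + z * c | x y z. True}" "t \<in> {x * m + y * b + z * c | x y z. True}"
  then obtain x y z x' y' z' where "s = x * m + y * b + z * c" "t = x' * m + y' * b + z' * c"
    by blast
  then have "s + t = (x + x') * m + (y + y') * b + (z + z') * c"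
    by (simp add: distrib_right)
  then show "s + t \<in> {x * m + y * b + z * c | x y z. True}" by blast
qed

lemma combination_of_atoms:
  assumes "atoms S \<subseteq> {m, b, c}" "s \<in> S"
  shows "\<exists>x y z. s = x * m + y * b + z * c"
proof -
  let ?T = "{x * m + y * b + z * c | x y z. True}"
  have "m = 1 * m + 0 * b + 0 * c" "b = 0 * m + 1 * b + 0 * c" "c = 0 * m + 0 * b + 1 * c"
    by simp_all
  then have "{m, b, c} \<subseteq> ?T" by blast
  with assms(1) have "atoms S \<subseteq> ?T" by (rule order_trans)
  then have "add_submonoid hull (atoms S) \<subseteq> ?T"
    using combinations_submonoid by (rule hull_minimal)
  with assms(2) show ?thesis using hull_atoms[OF submonoid] by auto
qed

lemma atom_in: "a \<in> atoms S \<Longrightarrow> a \<in> S \<and> 0 < a"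
  by (simp add: atoms_def)

text \<open>
  If \<open>2 * \<nu> < m \<le> 8\<close>, then at most two atoms differ from \<open>m\<close>. A single atom \<open>m\<close> would
  generate only multiples of \<open>m\<close>, so that \<open>m = 1\<close>, which is not greater than \<open>2 * \<nu>\<close>.
\<close>

lemma wilf_multiplicity_le_8:
  assumes "m \<le> 8"
  shows "F + 1 \<le> card (atoms S) * card {s \<in> S. s \<le> F}"
proof (cases "m \<le> 2 * card (atoms S)")
  case True
  then show ?thesis by (rule wilf_many_generators)
next
  case False
  with assms have le: "card (atoms S - {m}) \<le> 2"
    using m_atom finite_atoms by simp
  have suc: "card (atoms S) = Suc (card (atoms S - {m}))"
    using m_atom finite_atoms by (metis card.remove)
  consider "card (atoms S - {m}) = 0" | "card (atoms S - {m}) = 1" | "card (atoms S - {m}) = 2"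
    using le by linarith
  then show ?thesis
  proof cases
    case 1
    then have "atoms S \<subseteq> {m, m, m}" using finite_atoms by auto
    moreover have "F < F * m + 1" using m_pos by (cases m) auto
    then have "F * m + 1 \<in> S" by (rule above_F)
    ultimately obtain x y z where "F * m + 1 = x * m + y * m + z * m"
      using combination_of_atoms by blast
    then have "m dvd (F * m + 1) - F * m" by (intro dvd_diff_nat) simp_all
    then have "m = 1" by simp
    with False suc show ?thesis by simp
  next
    case 2
    then obtain b where b: "atoms S - {m} = {b}" by (auto simp: card_1_singleton_iff)
    then have sub: "atoms S \<subseteq> {m, b, m}" by blast
    have "\<exists>x y. s = x * m + y * b" if s: "s \<in> S" for s
    proof -
      obtain x y z where "s = x * m + y * b + z * m"
        using combination_of_atoms[OF sub s] by blast
      then have "s = (x + z) * m + y * b" by (simp add: algebra_simps)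
      then show ?thesis by blast
    qed
    moreover have "b \<in> S" using b atom_in by blast
    ultimately have "F + 1 \<le> 2 * card {s \<in> S. s \<le> F}"
      by (intro wilf_two_generators)
    then show ?thesis using suc 2 by simp
  next
    case 3
    then obtain b c where bc: "atoms S - {m} = {b, c}" by (auto simp: card_2_iff)
    then have pos: "b \<in> S" "c \<in> S" "0 < b" "0 < c" using atom_in by blast+
    have "atoms S \<subseteq> {m, b, c}" using bc by blast
    from combination_of_atoms[OF this] have "F + 1 \<le> 3 * card {s \<in> S. s \<le> F}"
      by (rule wilf_three_generators[OF pos])
    then show ?thesis using suc 3 by simp
  qed
qed

end

theorem corollary19:
  fixes S :: "nat set"
  assumes "numerical_semigroup S"
    and "multiplicity S \<le> 8"
  shows "frobenius_number S + 1 \<le> int (left_count S * embedding_dimension S)"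
proof (cases "frobenius_number S < 0")
  \<comment> \<open>Here \<open>S\<close> contains all natural numbers, and the Frobenius number is \<open>-1\<close>.\<close>
  case True
  then have "frobenius_number S + 1 \<le> 0" by simp
  also have "0 \<le> int (left_count S * embedding_dimension S)" by (rule of_nat_0_le_iff)
  finally show ?thesis .
next
  case False
  define F where "F = nat (frobenius_number S)"
  have F: "frobenius_number S = int F" using False by (simp add: F_def)
  have sub: "add_submonoid S" using assms(1) by (simp add: numerical_semigroup_def)
  have F_notin: "F \<notin> S"
    using frobenius_number_greatest(1)[OF assms(1)] F by auto
  have above: "x \<in> S" if "F < x" for x
    using frobenius_number_greatest(2)[OF assms(1), of "int x"] F that by (cases "x \<in> S") (auto simp: image_iff)
  have "\<exists>s. s \<in> S \<and> 0 < s"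
    using above[of "Suc F"] by blast
  from LeastI_ex[OF this] have mult: "multiplicity S \<in> S" "0 < multiplicity S"
    by (simp_all add: multiplicity_def)
  interpret apery_setting S "multiplicity S" F
  proof
    show "multiplicity S \<le> s" if "s \<in> S" "0 < s" for s
      unfolding multiplicity_def using that by (intro Least_le) simp
  qed (use sub mult F_notin above in auto)
  have "{s \<in> S. int s < frobenius_number S} = {s \<in> S. s \<le> F}"
    using F_notin by (auto simp: F order_le_less)
  then have "left_count S = card {s \<in> S. s \<le> F}"
    by (simp add: left_count_def)
  moreover have "embedding_dimension S = card (atoms S)"
    by (simp add: embedding_dimension_def minimal_generating_set_iff[OF sub])
  ultimately have "F + 1 \<le> left_count S * embedding_dimension S"
    using wilf_multiplicity_le_8[OF assms(2)] by (simp add: mult.commute)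
  then have "int (F + 1) \<le> int (left_count S * embedding_dimension S)"
    by (simp only: of_nat_le_iff)
  then show ?thesis by (simp add: F)
qed

end
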